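(* Let $(\mathfrak{g},[\cdot,\cdot],B)$ be a real finite-dimensional quadratic Lie algebra and let $\alpha\in Aut_S(B,\mathfrak{g})$ be an involution ($\alpha^2=id$). Let $T:\mathfrak{g}\otimes\mathfrak{g}\to\mathfrak{g}$ be the linear map determined by $B(T(x\otimes y),z)=B([z,x],y)$ for all $x,y,z\in\mathfrak{g}$, and define the ternary bracket $[x,y,z]=[T(x\otimes y),z]$ on $\mathfrak{g}$. Then $(\mathfrak{g},\alpha\circ[\cdot,\cdot,\cdot],(\alpha,\alpha),B_\alpha)$, where $B_\alpha(x,y)=B(\alpha(x),y)$, is a quadratic multiplicative ternary Hom-Nambu algebra.
   Context: A quadratic Lie algebra $(\mathfrak{g},[\cdot,\cdot],B)$ is a Lie algebra with a nondegenerate symmetric bilinear form $B$ satisfying $B([x,y],z)+B(y,[x,z])=0$. $Aut_S(B,\mathfrak{g})$ is the set of Lie algebra automorphisms $f$ of $\mathfrak{g}$ with $B(f(x),y)=B(x,f(y))$ for all $x,y$. A multiplicative ternary Hom-Nambu algebra $(V,[\cdot,\cdot,\cdot],(\alpha,\alpha))$ is a vector space with a trilinear bracket and a linear map $\alpha$ such that $\alpha([x,y,z])=[\alpha(x),\alpha(y),\alpha(z)]$ and $$[\alpha(x_1),\alpha(x_2),[y_1,y_2,y_3]]=[[x_1,x_2,y_1],\alpha(y_2),\alpha(y_3)]+[\alpha(y_1),[x_1,x_2,y_2],\alpha(y_3)]+[\alpha(y_1),\alpha(y_2),[x_1,x_2,y_3]].$$ It is quadratic with respect to $B$ if $B$ is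 a nondegenerate symmetric bilinear form on $V$ with $B([x_1,x_2,y],z)+B(y,[x_1,x_2,z])=0$ and $B(\alpha(y),z)=B(y,\alpha(z))$ for all elements. *)

theory Defs
  imports "HOL-Analysis.Analysis" "HOL-Analysis.Finite_Function_Topology"
begin

section \<open>Tensor product of real vector spaces\<close>

text \<open>
  The free real vector space on \<open>'a \<times> 'b\<close> is \<open>'a \<times> 'b \<Rightarrow>\<^sub>0 real\<close>;
  the tensor product is its quotient by the span of the bilinearity relators.
\<close>

inductive_set tensor_relators :: "('a::real_vector \<times> 'b::real_vector \<Rightarrow>\<^sub>0 real) set" where
  add_left: "Poly_Mapping.single (x + x', y) 1 - Poly_Mapping.single (x, y) 1
     - Poly_Mapping.single (x', y) 1 \<in> tensor_relators"
| add_right: "Poly_Mapping.single (x, y + y') 1 - Poly_Mapping.single (x, y) 1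
     - Poly_Mapping.single (x, y') 1 \<in> tensor_relators"
| scale_left: "Poly_Mapping.single (r *\<^sub>R x, y) 1 - r *\<^sub>R Poly_Mapping.single (x, y) 1
     \<in> tensor_relators"
| scale_right: "Poly_Mapping.single (x, r *\<^sub>R y) 1 - r *\<^sub>R Poly_Mapping.single (x, y) 1
     \<in> tensor_relators"

definition tensor_rel ::
  "('a::real_vector \<times> 'b::real_vector \<Rightarrow>\<^sub>0 real) \<Rightarrow> ('a \<times> 'b \<Rightarrow>\<^sub>0 real) \<Rightarrow> bool" where
  "tensor_rel u v \<longleftrightarrow> u - v \<in> span tensor_relators"

lemma tensor_rel_refl: "tensor_rel u u"
  by (simp add: tensor_rel_def span_zero)

lemma tensor_rel_sym: "tensor_rel u v \<Longrightarrow> tensor_rel v u"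
  unfolding tensor_rel_def using span_neg[of "u - v"] by simp

lemma tensor_rel_trans: "tensor_rel u v \<Longrightarrow> tensor_rel v w \<Longrightarrow> tensor_rel u w"
  unfolding tensor_rel_def using span_add[of "u - v" _ "v - w"] by simp

lemma tensor_rel_add:
  "tensor_rel u u' \<Longrightarrow> tensor_rel v v' \<Longrightarrow> tensor_rel (u + v) (u' + v')"
  unfolding tensor_rel_def add_diff_add by (rule span_add)

lemma tensor_rel_scaleR: "tensor_rel u u' \<Longrightarrow> tensor_rel (r *\<^sub>R u) (r *\<^sub>R u')"
  unfolding tensor_rel_def scaleR_diff_right[symmetric] by (rule span_scale)

lemma tensor_rel_uminus: "tensor_rel u u' \<Longrightarrow> tensor_rel (- u) (- u')"
  using tensor_rel_scaleR[of u u' "-1"] by simp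

lemma tensor_rel_diff:
  "tensor_rel u u' \<Longrightarrow> tensor_rel v v' \<Longrightarrow> tensor_rel (u - v) (u' - v')"
  using tensor_rel_add[OF _ tensor_rel_uminus, of u u' v v'] by simp

lemma tensor_rel_equivp: "equivp tensor_rel"
  by (intro equivpI reflpI sympI transpI)
    (fact tensor_rel_refl, erule tensor_rel_sym, erule (1) tensor_rel_trans)

quotient_type (overloaded) ('a, 'b) tensor =
  "'a::real_vector \<times> 'b::real_vector \<Rightarrow>\<^sub>0 real" / tensor_rel
  by (rule tensor_rel_equivp)

instantiation tensor :: (real_vector, real_vector) real_vector
begin

lift_definition zero_tensor :: "('a, 'b) tensor" is 0 .

lift_definition plus_tensor :: "('a, 'b) tensor \<Rightarrow> ('a, 'b) tensor \<Rightarrow> ('a, 'b) tensor"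
  is "(+)" by (rule tensor_rel_add)

lift_definition uminus_tensor :: "('a, 'b) tensor \<Rightarrow> ('a, 'b) tensor"
  is uminus by (rule tensor_rel_uminus)

lift_definition minus_tensor :: "('a, 'b) tensor \<Rightarrow> ('a, 'b) tensor \<Rightarrow> ('a, 'b) tensor"
  is "(-)" by (rule tensor_rel_diff)

lift_definition scaleR_tensor :: "real \<Rightarrow> ('a, 'b) tensor \<Rightarrow> ('a, 'b) tensor"
  is scaleR by (rule tensor_rel_scaleR)

instance
proof
  fix a b c :: "('a, 'b) tensor" and r s :: real
  note refl = tensor_rel_refl
  show "a + b + c = a + (b + c)" by transfer (simp add: add.assoc refl)
  show "a + b = b + a" by transfer (simp add: add.commute refl)
  show "0 + a = a" by transfer (simp add: refl)
  show "- a + a = 0" by transfer (simp add: refl)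
  show "a - b = a + - b" by transfer (simp add: refl)
  show "r *\<^sub>R (a + b) = r *\<^sub>R a + r *\<^sub>R b" by transfer (simp add: scaleR_add_right refl)
  show "(r + s) *\<^sub>R a = r *\<^sub>R a + s *\<^sub>R a" by transfer (simp add: scaleR_add_left refl)
  show "r *\<^sub>R s *\<^sub>R a = (r * s) *\<^sub>R a" by transfer (simp add: refl)
  show "1 *\<^sub>R a = a" by transfer (simp add: refl)
qed

end

lift_definition tensor :: "'a::real_vector \<Rightarrow> 'b::real_vector \<Rightarrow> ('a, 'b) tensor"
    (infixl \<open>\<otimes>\<^sub>t\<close> 70)
  is "\<lambda>x y. Poly_Mapping.single (x, y) 1" .

lemma bilinear_tensor: "bilinear (\<otimes>\<^sub>t)"
proof -
  have "x \<otimes>\<^sub>t (y + y') = x \<otimes>\<^sub>t y + x \<otimes>\<^sub>t y'"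
    for x :: 'a and y y' :: 'b
    by transfer (use span_base[OF tensor_relators.add_right] in \<open>simp add: tensor_rel_def diff_diff_eq\<close>)
  moreover have "(x + x') \<otimes>\<^sub>t y = x \<otimes>\<^sub>t y + x' \<otimes>\<^sub>t y"
    for x x' :: 'a and y :: 'b
    by transfer (use span_base[OF tensor_relators.add_left] in \<open>simp add: tensor_rel_def diff_diff_eq\<close>)
  moreover have "x \<otimes>\<^sub>t (r *\<^sub>R y) = r *\<^sub>R (x \<otimes>\<^sub>t y)"
    for x :: 'a and y :: 'b and r
    by transfer (simp add: tensor_rel_def span_base tensor_relators.scale_right)
  moreover have "(r *\<^sub>R x) \<otimes>\<^sub>t y = r *\<^sub>R (x \<otimes>\<^sub>t y)"
    for x :: 'a and y :: 'b and r
    by transfer (simp add: tensor_rel_def span_base tensor_relators.scale_left)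
  ultimately show ?thesis
    unfolding bilinear_def by (auto intro!: linearI)
qed

lemma free_in_span_single:
  "u \<in> span (range (\<lambda>p. Poly_Mapping.single p (1::real)))"
proof (induction u rule: update_induct)
  case const
  show ?case by (rule span_zero)
next
  case (update f a b)
  have "Poly_Mapping.update a b f = f + b *\<^sub>R Poly_Mapping.single a 1"
  proof (rule poly_mapping_eqI)
    fix k
    have "Poly_Mapping.lookup (b *\<^sub>R Poly_Mapping.single a (1::real)) k
        = b * Poly_Mapping.lookup (Poly_Mapping.single a 1) k"
      by (simp add: scaleR_poly_mapping_def)
    then show "Poly_Mapping.lookup (Poly_Mapping.update a b f) k
        = Poly_Mapping.lookup (f + b *\<^sub>R Poly_Mapping.single a 1) k"
      using update(1) by (auto simp: lookup_update lookup_add lookup_single when_def in_keys_iff)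
  qed
  then show ?case
    using update(3) by (simp add: span_add span_scale span_base)
qed

lemma abs_tensor_surj: "\<exists>u. t = abs_tensor u"
  by (rule exI[of _ "rep_tensor t"]) (rule Quotient3_abs_rep[OF Quotient3_tensor, symmetric])

lemma span_pure_tensors: "span {x \<otimes>\<^sub>t y | x y. True} = UNIV"
proof -
  have "abs_tensor u \<in> span {x \<otimes>\<^sub>t y | x y. True}" for u :: "'a \<times> 'b \<Rightarrow>\<^sub>0 real"
    using free_in_span_single[of u]
  proof (induction rule: span_induct_alt)
    case base
    show ?case by (metis span_zero zero_tensor.abs_eq)
  next
    case (step c p v)
    then obtain x y where p: "p = Poly_Mapping.single (x, y) 1" by auto
    have "abs_tensor (c *\<^sub>R p + v) = c *\<^sub>R (x \<otimes>\<^sub>t y) + abs_tensor v"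
      by (simp add: p plus_tensor.abs_eq scaleR_tensor.abs_eq tensor.abs_eq)
    moreover have "x \<otimes>\<^sub>t y \<in> span {x \<otimes>\<^sub>t y | x y. True}"
      by (rule span_base) auto
    ultimately show ?case
      using step by (simp add: span_add span_scale)
  qed
  then show ?thesis
    using abs_tensor_surj by (metis (no_types, lifting) UNIV_eq_I)
qed

theorem tensor_universal:
  fixes f :: "'a::real_vector \<Rightarrow> 'b::real_vector \<Rightarrow> 'c::real_vector"
  assumes "bilinear f"
  shows "\<exists>!F. linear F \<and> (\<forall>x y. F (x \<otimes>\<^sub>t y) = f x y)"
proof (rule ex_ex1I)
  define g where "g u = (\<Sum>p\<in>Poly_Mapping.keys u. Poly_Mapping.lookup u p *\<^sub>R f (fst p) (snd p))"
    for u :: "'a \<times> 'b \<Rightarrow>\<^sub>0 real"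
  have lookup_scale: "Poly_Mapping.lookup (r *\<^sub>R u) p = r * Poly_Mapping.lookup u p"
    for r and u :: "'a \<times> 'b \<Rightarrow>\<^sub>0 real" and p
  proof -
    have "finite {i. r *\<^sub>R Poly_Mapping.lookup u i \<noteq> 0}"
      by (rule finite_subset[OF _ finite_keys[of u]]) (auto simp: in_keys_iff)
    then show ?thesis by (simp add: scaleR_poly_mapping_def)
  qed
  have g_sup: "g u = (\<Sum>p\<in>A. Poly_Mapping.lookup u p *\<^sub>R f (fst p) (snd p))"
    if "finite A" "Poly_Mapping.keys u \<subseteq> A" for u A
    unfolding g_def using that by (intro sum.mono_neutral_left) (auto simp: in_keys_iff)
  have "linear g"
  proof (rule linearI)
    fix u v :: "'a \<times> 'b \<Rightarrow>\<^sub>0 real"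
    let ?A = "Poly_Mapping.keys u \<union> Poly_Mapping.keys v"
    show "g (u + v) = g u + g v"
      by (subst (1 2 3) g_sup[of ?A])
        (auto simp: keys_add lookup_add scaleR_add_left sum.distrib in_keys_iff)
  next
    fix r and u :: "'a \<times> 'b \<Rightarrow>\<^sub>0 real"
    show "g (r *\<^sub>R u) = r *\<^sub>R g u"
      by (subst (1 2) g_sup[of "Poly_Mapping.keys u"])
        (auto simp: lookup_scale in_keys_iff scaleR_sum_right)
  qed
  have g_single: "g (Poly_Mapping.single (x, y) 1) = f x y" for x y
    by (simp add: g_def)
  have "g u = 0" if "u \<in> tensor_relators" for u
    using that
    by cases (simp_all add: linear_diff[OF \<open>linear g\<close>] linear_scale[OF \<open>linear g\<close>] g_single
        bilinear_ladd[OF assms] bilinear_radd[OF assms] bilinear_lmul[OF assms]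
        bilinear_rmul[OF assms])
  then have g_rel: "g u = g v" if "tensor_rel u v" for u v
    using that linear_eq_0_on_span[OF \<open>linear g\<close>, of tensor_relators "u - v"]
    by (simp add: tensor_rel_def linear_diff[OF \<open>linear g\<close>])
  define F where "F t = g (rep_tensor t)" for t :: "('a, 'b) tensor"
  have F_abs: "F (abs_tensor u) = g u" for u
    unfolding F_def
    by (rule g_rel) (rule rep_abs_rsp_left[OF Quotient3_tensor tensor_rel_refl])
  have "linear F"
  proof (rule linearI)
    fix s t :: "('a, 'b) tensor"
    obtain u v where "s = abs_tensor u" "t = abs_tensor v" using abs_tensor_surj by metis
    then show "F (s + t) = F s + F t"
      by (simp add: plus_tensor.abs_eq F_abs linear_add[OF \<open>linear g\<close>])
  next
    fix r and t :: "('a, 'b) tensor"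
    obtain u where "t = abs_tensor u" using abs_tensor_surj by metis
    then show "F (r *\<^sub>R t) = r *\<^sub>R F t"
      by (simp add: scaleR_tensor.abs_eq F_abs linear_scale[OF \<open>linear g\<close>])
  qed
  then show "\<exists>F. linear F \<and> (\<forall>x y. F (x \<otimes>\<^sub>t y) = f x y)"
    by (intro exI[of _ F]) (auto simp: tensor.abs_eq F_abs g_single)
next
  fix F G :: "('a, 'b) tensor \<Rightarrow> 'c"
  assume F: "linear F \<and> (\<forall>x y. F (x \<otimes>\<^sub>t y) = f x y)"
    and G: "linear G \<and> (\<forall>x y. G (x \<otimes>\<^sub>t y) = f x y)"
  show "F = G"
  proof
    fix t :: "('a, 'b) tensor"
    have t: "t \<in> span {x \<otimes>\<^sub>t y | x y. True}" unfolding span_pure_tensors by simp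
    show "F t = G t"
      by (rule linear_eq_on_span[OF _ _ _ t]) (use F G in auto)
  qed
qed

section \<open>Quadratic Lie algebras\<close>

definition lie_bracket :: "('a::real_vector \<Rightarrow> 'a \<Rightarrow> 'a) \<Rightarrow> bool" where
  "lie_bracket br \<longleftrightarrow> bilinear br \<and> (\<forall>x. br x x = 0) \<and>
     (\<forall>x y z. br x (br y z) + br y (br z x) + br z (br x y) = 0)"

definition nondeg_sym_bilinear_form :: "('a::real_vector \<Rightarrow> 'a \<Rightarrow> real) \<Rightarrow> bool" where
  "nondeg_sym_bilinear_form B \<longleftrightarrow> bilinear B \<and> (\<forall>x y. B x y = B y x) \<and>
     (\<forall>x. (\<forall>y. B x y = 0) \<longrightarrow> x = 0)"

definition quadratic_lie_algebra ::
  "('a::real_vector \<Rightarrow> 'a \<Rightarrow> 'a) \<Rightarrow> ('a \<Rightarrow> 'a \<Rightarrow> real) \<Rightarrow> bool" where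
  "quadratic_lie_algebra br B \<longleftrightarrow> lie_bracket br \<and> nondeg_sym_bilinear_form B \<and>
     (\<forall>x y z. B (br x y) z + B y (br x z) = 0)"

text \<open>
  The linear map \<open>T\<close> determined by \<open>B (T (x \<otimes>\<^sub>t y)) z = B (br z x) y\<close>
  exists and is unique.
\<close>

lemma T_map_exists_unique:
  assumes "quadratic_lie_algebra br B"
  shows "\<exists>!T. linear T \<and> (\<forall>x y z. B (T (x \<otimes>\<^sub>t y)) z = B (br z x) y)"
proof -
  have L: "lie_bracket br" and N: "nondeg_sym_bilinear_form B"
    and inv: "\<And>x y z. B (br x y) z + B y (br x z) = 0"
    using assms by (auto simp: quadratic_lie_algebra_def)
  have bb: "bilinear br" using L by (simp add: lie_bracket_def)
  have bB: "bilinear B" using N by (simp add: nondeg_sym_bilinear_form_def)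
  have skew: "br x y = - br y x" for x y
  proof -
    have "br (x + y) (x + y) = 0" "br x x = 0" "br y y = 0"
      using L by (auto simp: lie_bracket_def)
    then have "br x y + br y x = 0"
      by (simp add: bilinear_ladd[OF bb] bilinear_radd[OF bb] add.commute)
    then show ?thesis by (simp add: eq_neg_iff_add_eq_0)
  qed
  have val: "B (br x y) z = B (br z x) y" for x y z
  proof -
    have "B (br z x) y = - B (br x z) y"
      by (subst skew) (simp add: bilinear_lneg[OF bB])
    also have "\<dots> = B z (br x y)" using inv[of x z y] by simp
    also have "\<dots> = B (br x y) z" using N by (simp add: nondeg_sym_bilinear_form_def)
    finally show ?thesis by simp
  qed
  have eqI: "a = b" if "\<And>z. B a z = B b z" for a b
  proof -
    have "\<forall>z. B (a - b) z = 0" by (simp add: bilinear_lsub[OF bB] that)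
    then have "a - b = 0" using N unfolding nondeg_sym_bilinear_form_def by blast
    then show ?thesis by simp
  qed
  have "(linear T \<and> (\<forall>x y z. B (T (x \<otimes>\<^sub>t y)) z = B (br z x) y))
      \<longleftrightarrow> linear T \<and> (\<forall>x y. T (x \<otimes>\<^sub>t y) = br x y)" for T
  proof -
    have "(\<forall>z. B (T (x \<otimes>\<^sub>t y)) z = B (br z x) y) \<longleftrightarrow> T (x \<otimes>\<^sub>t y) = br x y" for x y
      using eqI[of "T (x \<otimes>\<^sub>t y)" "br x y"] val[of x y] by auto
    then show ?thesis by simp
  qed
  then show ?thesis using tensor_universal[OF bb] by simp
qed

definition Aut\<^sub>S ::
  "('a::real_vector \<Rightarrow> 'a \<Rightarrow> 'a) \<Rightarrow> ('a \<Rightarrow> 'a \<Rightarrow> real) \<Rightarrow> ('a \<Rightarrow> 'a) set" where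
  "Aut\<^sub>S br B = {f. linear f \<and> bij f \<and> (\<forall>x y. f (br x y) = br (f x) (f y)) \<and>
     (\<forall>x y. B (f x) y = B x (f y))}"

section \<open>Quadratic multiplicative ternary Hom-Nambu algebras\<close>

definition trilinear ::
  "('a::real_vector \<Rightarrow> 'b::real_vector \<Rightarrow> 'c::real_vector \<Rightarrow> 'd::real_vector) \<Rightarrow> bool" where
  "trilinear t \<longleftrightarrow> (\<forall>y z. linear (\<lambda>x. t x y z)) \<and> (\<forall>x z. linear (\<lambda>y. t x y z)) \<and>
     (\<forall>x y. linear (\<lambda>z. t x y z))"

text \<open>The ternary bracket is only trilinear; skew-symmetry is not required.\<close>

definition mult_ternary_hom_nambu ::
  "('a::real_vector \<Rightarrow> 'a \<Rightarrow> 'a \<Rightarrow> 'a) \<Rightarrow> ('a \<Rightarrow> 'a) \<Rightarrow> bool" where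
  "mult_ternary_hom_nambu t \<alpha> \<longleftrightarrow> trilinear t \<and> linear \<alpha> \<and>
     (\<forall>x y z. \<alpha> (t x y z) = t (\<alpha> x) (\<alpha> y) (\<alpha> z)) \<and>
     (\<forall>x1 x2 y1 y2 y3. t (\<alpha> x1) (\<alpha> x2) (t y1 y2 y3) =
        t (t x1 x2 y1) (\<alpha> y2) (\<alpha> y3) + t (\<alpha> y1) (t x1 x2 y2) (\<alpha> y3)
        + t (\<alpha> y1) (\<alpha> y2) (t x1 x2 y3))"

definition quadratic_mult_ternary_hom_nambu ::
  "('a::real_vector \<Rightarrow> 'a \<Rightarrow> 'a \<Rightarrow> 'a) \<Rightarrow> ('a \<Rightarrow> 'a) \<Rightarrow> ('a \<Rightarrow> 'a \<Rightarrow> real) \<Rightarrow> bool" where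
  "quadratic_mult_ternary_hom_nambu t \<alpha> B \<longleftrightarrow>
     mult_ternary_hom_nambu t \<alpha> \<and> nondeg_sym_bilinear_form B \<and>
     (\<forall>x1 x2 y z. B (t x1 x2 y) z + B y (t x1 x2 z) = 0) \<and>
     (\<forall>y z. B (\<alpha> y) z = B y (\<alpha> z))"

end

theory Submission
  imports Defs
begin

text \<open>
  Invariance of \<open>B\<close> forces \<open>T (x \<otimes> y) = [x, y]\<close>, so the ternary bracket is \<open>[[x, y], z]\<close>.
  Its fundamental identity is the Jacobi identity: \<open>[[x\<^sub>1, x\<^sub>2], \<sqdot>]\<close> is a derivation of the
  Lie bracket. Since \<open>\<alpha>\<close> is an automorphism, it can be pulled out of all brackets, which
  turns the Hom-Nambu identity into \<open>\<alpha>\<^sup>2\<close> applied to the untwisted one. For the form,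
  \<open>\<alpha>\<close> is \<open>B\<close>-symmetric with \<open>\<alpha>\<^sup>2 = id\<close>, hence a \<open>B\<close>-isometry.
\<close>

lemma lie_bracket_skew:
  assumes "lie_bracket br"
  shows "br x y = - br y x"
proof -
  have bil: "bilinear br" and alt: "\<And>x. br x x = 0"
    using assms by (auto simp: lie_bracket_def)
  have "br x y + br y x = 0"
    using alt[of "x + y"] alt[of x] alt[of y]
    by (simp add: bilinear_ladd[OF bil] bilinear_radd[OF bil] add.commute)
  then show ?thesis by (simp add: eq_neg_iff_add_eq_0)
qed

text \<open>This is the Jacobi identity with two of its terms reordered by skew-symmetry, so that
  \<open>br u\<close> acts as a derivation.\<close>

lemma lie_bracket_derivation:
  assumes "lie_bracket br"
  shows "br u (br x y) = br (br u x) y + br x (br u y)"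
proof -
  have bil: "bilinear br" and "br u (br x y) + br x (br y u) + br y (br u x) = 0"
    using assms by (auto simp: lie_bracket_def)
  moreover have "br x (br y u) = - br x (br u y)"
    using lie_bracket_skew[OF assms, of y u] bilinear_rneg[OF bil] by simp
  moreover have "br y (br u x) = - br (br u x) y"
    by (rule lie_bracket_skew[OF assms])
  ultimately show ?thesis
    by (simp add: algebra_simps)
qed

text \<open>The Leibniz rule for \<open>br u\<close> is applied to the outer and then to the inner
  bracket. Taking \<open>u\<close> itself to be a bracket gives the untwisted Nambu
  identity.\<close>

lemma lie_bracket_triple_derivation:
  assumes "lie_bracket br"
  shows "br u (br (br x y) z) =
    br (br (br u x) y) z + br (br x (br u y)) z + br (br x y) (br u z)"
proof -
  have bil: "bilinear br" using assms by (simp add: lie_bracket_def)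
  show ?thesis
    using lie_bracket_derivation[OF assms, of u "br x y" z]
      lie_bracket_derivation[OF assms, of u x y]
    by (simp add: bilinear_ladd[OF bil])
qed

lemma quadratic_lie_algebra_T_eq_bracket:
  assumes "quadratic_lie_algebra br B"
    and T: "\<And>x y z. B (T (x \<otimes>\<^sub>t y)) z = B (br z x) y"
  shows "T (x \<otimes>\<^sub>t y) = br x y"
proof -
  have L: "lie_bracket br" and bB: "bilinear B" and sym: "\<And>x y. B x y = B y x"
    and nondeg: "\<And>x. (\<And>y. B x y = 0) \<Longrightarrow> x = 0"
    and inv: "\<And>x y z. B (br x y) z + B y (br x z) = 0"
    using assms(1) by (auto simp: quadratic_lie_algebra_def nondeg_sym_bilinear_form_def)
  have "B (T (x \<otimes>\<^sub>t y)) z = B (br x y) z" for z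
    \<comment> \<open>The chain is B([z,x],y) = -B([x,z],y) = B(z,[x,y]) = B([x,y],z).\<close>
    using inv[of x z y] sym[of z "br x y"] lie_bracket_skew[OF L, of z x]
    by (simp add: T bilinear_lneg[OF bB])
  then have "T (x \<otimes>\<^sub>t y) - br x y = 0"
    by (intro nondeg) (simp add: bilinear_lsub[OF bB])
  then show ?thesis by simp
qed

text \<open>Self-adjointness of \<open>f\<close> keeps the form symmetric; injectivity keeps it
  nondegenerate, since a vector \<open>x\<close> in the new radical satisfies
  \<open>f x = 0\<close>.\<close>

lemma nondeg_sym_bilinear_form_twist:
  assumes "nondeg_sym_bilinear_form B" and lin: "linear f" and "inj f"
    and symf: "\<And>x y. B (f x) y = B x (f y)"
  shows "nondeg_sym_bilinear_form (\<lambda>x y. B (f x) y)"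
proof -
  have bB: "bilinear B" and sym: "\<And>x y. B x y = B y x"
    and nondeg: "\<And>x. \<forall>y. B x y = 0 \<Longrightarrow> x = 0"
    using assms(1) by (auto simp: nondeg_sym_bilinear_form_def)
  have "bilinear (\<lambda>x y. B (f x) y)"
    unfolding bilinear_def
    by (auto intro!: linearI simp: linear_add[OF lin] linear_scale[OF lin]
        bilinear_ladd[OF bB] bilinear_radd[OF bB] bilinear_lmul[OF bB] bilinear_rmul[OF bB])
  moreover have "B (f x) y = B (f y) x" for x y
    using sym[of x "f y"] by (simp only: symf)
  moreover have "x = 0" if "\<forall>y. B (f x) y = 0" for x
    using nondeg[OF that] \<open>inj f\<close> linear_0[OF lin] by (metis injD)
  ultimately show ?thesis
    unfolding nondeg_sym_bilinear_form_def by blast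
qed

text \<open>Twisting principle: composing the Nambu bracket [[x,y],z] with a Lie algebra
  endomorphism gives a Hom-Nambu bracket.\<close>

lemma lie_bracket_twisted_triple_hom_nambu:
  assumes L: "lie_bracket br" and lin: "linear f"
    and hom: "\<And>x y. f (br x y) = br (f x) (f y)"
  shows "mult_ternary_hom_nambu (\<lambda>x y z. f (br (br x y) z)) f"
proof -
  have bil: "bilinear br" using L by (simp add: lie_bracket_def)
  have "trilinear (\<lambda>x y z. f (br (br x y) z))"
    unfolding trilinear_def
    by (auto intro!: linearI simp: linear_add[OF lin] linear_scale[OF lin]
        bilinear_ladd[OF bil] bilinear_radd[OF bil] bilinear_lmul[OF bil] bilinear_rmul[OF bil])
  moreover have "f (f (br (br x y) z)) = f (br (br (f x) (f y)) (f z))" for x y z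
    by (simp add: hom)
  moreover have "f (br (br (f x1) (f x2)) (f (br (br y1 y2) y3))) =
      f (br (br (f (br (br x1 x2) y1)) (f y2)) (f y3)) +
      f (br (br (f y1) (f (br (br x1 x2) y2))) (f y3)) +
      f (br (br (f y1) (f y2)) (f (br (br x1 x2) y3)))" for x1 x2 y1 y2 y3
    using lie_bracket_triple_derivation[OF L, of "br x1 x2" y1 y2 y3]
    \<comment> \<open>Read from right to left, the rules collect each side into
      \<open>f (f _)\<close> of the corresponding side of the untwisted identity.\<close>
    by (simp flip: hom linear_add[OF lin])
  ultimately show ?thesis
    unfolding mult_ternary_hom_nambu_def using lin by blast
qed

theorem proposition5p16:
  fixes br :: "'a::real_vector \<Rightarrow> 'a \<Rightarrow> 'a"
    and B :: "'a \<Rightarrow> 'a \<Rightarrow> real"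
    and \<alpha> :: "'a \<Rightarrow> 'a"
    and T :: "('a, 'a) tensor \<Rightarrow> 'a"
  assumes "\<exists>Bs. finite_dimensional_vector_space ((*\<^sub>R) :: real \<Rightarrow> 'a \<Rightarrow> 'a) Bs"
    and "quadratic_lie_algebra br B"
    and "\<alpha> \<in> Aut\<^sub>S br B"
    and "\<alpha> \<circ> \<alpha> = id"
    and "linear T"
    and "\<And>x y z. B (T (x \<otimes>\<^sub>t y)) z = B (br z x) y"
  shows "quadratic_mult_ternary_hom_nambu
           (\<lambda>x y z. \<alpha> (br (T (x \<otimes>\<^sub>t y)) z)) \<alpha> (\<lambda>x y. B (\<alpha> x) y)"
proof -
  have L: "lie_bracket br" and N: "nondeg_sym_bilinear_form B"
    and inv: "\<And>x y z. B (br x y) z + B y (br x z) = 0"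
    using assms(2) by (auto simp: quadratic_lie_algebra_def)
  have lin: "linear \<alpha>" and "inj \<alpha>"
    and hom: "\<And>x y. \<alpha> (br x y) = br (\<alpha> x) (\<alpha> y)"
    and symf: "\<And>x y. B (\<alpha> x) y = B x (\<alpha> y)"
    using assms(3) by (auto simp: Aut\<^sub>S_def bij_is_inj)
  have invol: "\<alpha> (\<alpha> x) = x" for x
    using assms(4) by (metis comp_apply id_apply)
  have isom: "B (\<alpha> x) (\<alpha> y) = B x y" for x y
    by (simp add: symf invol)
  have T: "T (x \<otimes>\<^sub>t y) = br x y" for x y
    by (rule quadratic_lie_algebra_T_eq_bracket[OF assms(2)]) (rule assms(6))
  have "mult_ternary_hom_nambu (\<lambda>x y z. \<alpha> (br (br x y) z)) \<alpha>"
    by (rule lie_bracket_twisted_triple_hom_nambu[OF L lin]) (rule hom)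
  moreover have "nondeg_sym_bilinear_form (\<lambda>x y. B (\<alpha> x) y)"
    by (rule nondeg_sym_bilinear_form_twist[OF N lin \<open>inj \<alpha>\<close>]) (rule symf)
  \<comment> \<open>Both terms lose their \<alpha>'s, the first by involutivity and the second by
    isometry; what remains is invariance of \<open>B\<close> under
    \<open>br (br x1 x2)\<close>.\<close>
  moreover have "B (\<alpha> (\<alpha> (br (br x1 x2) y))) z + B (\<alpha> y) (\<alpha> (br (br x1 x2) z)) = 0"
    for x1 x2 y z
    by (simp only: invol isom inv)
  moreover have "B (\<alpha> (\<alpha> y)) z = B (\<alpha> y) (\<alpha> z)" for y z
    by (rule symf)
  ultimately show ?thesis
    unfolding quadratic_mult_ternary_hom_nambu_def T by blast
qed

end
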